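(* Let $n\ge 3$ and let $A_1,\dots,A_n$ be the vertices of a regular $n$-gon in the Euclidean plane. For any point $M$ on the circumscribed circle of the $n$-gon, with $d_i=|MA_i|$, $$3\left(\sum_{i=1}^n d_i^2\right)^2=2n\sum_{i=1}^n d_i^4.$$
   Context: $|MA_i|$ denotes Euclidean distance. *)

theory Defs
  imports "HOL-Analysis.Analysis"
begin

definition vertex_angle :: "real^2 \<Rightarrow> real^2 \<Rightarrow> real^2 \<Rightarrow> real" where
  "vertex_angle P Q R = arccos (((P - Q) \<bullet> (R - Q)) / (norm (P - Q) * norm (R - Q)))"

text \<open>Vertices are numbered \<open>1, \<dots>, n\<close>; the vertex after number \<open>n\<close> is number \<open>1\<close>.\<close>

definition next_vertex :: "nat \<Rightarrow> nat \<Rightarrow> nat" where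
  "next_vertex n i = (if i = n then 1 else i + 1)"

text \<open>
  For \<open>n \<ge> 3\<close>, the points \<open>A 1, \<dots>, A n\<close> are, in this cyclic order (of either orientation),
  the vertices of a convex polygon iff they are distinct and each segment joining consecutive
  points is an edge of their convex hull. An endpoint of an edge is an extreme point of the
  hull, so no vertex lies on a side between two others; distinctness also excludes that the
  boundary is traversed more than once.
\<close>

definition convex_polygon :: "nat \<Rightarrow> (nat \<Rightarrow> real^2) \<Rightarrow> bool" where
  "convex_polygon n A \<longleftrightarrow>
     inj_on A {1..n} \<and>
     (\<forall>i\<in>{1..n}. closed_segment (A i) (A (next_vertex n i)) edge_of (convex hull (A ` {1..n})))"

definition regular_polygon :: "nat \<Rightarrow> (nat \<Rightarrow> real^2) \<Rightarrow> bool" where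
  "regular_polygon n A \<longleftrightarrow>
     convex_polygon n A \<and>
     (\<exists>s. \<forall>i\<in>{1..n}. dist (A i) (A (next_vertex n i)) = s) \<and>
     (\<exists>\<alpha>. \<forall>i\<in>{1..n}.
        vertex_angle (A i) (A (next_vertex n i)) (A (next_vertex n (next_vertex n i))) = \<alpha>)"

definition circumscribed_circle :: "nat \<Rightarrow> (nat \<Rightarrow> real^2) \<Rightarrow> (real^2) set \<Rightarrow> bool" where
  "circumscribed_circle n A C \<longleftrightarrow> (\<exists>c r. r > 0 \<and> C = sphere c r) \<and> A ` {1..n} \<subseteq> C"

end

theory Submission
  imports Defs
begin

text \<open>
  Read the vertices as complex numbers with the centre of the circle at the origin. Equal sides mean
  that the quotients of consecutive vertices are unit complex numbers with the same real part, so
  any two of them are equal or conjugate. Two consecutive quotients cannot be conjugate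
  unless they are equal, because their product is not 1: the vertices two steps apart differ. Hence
  the vertices are \<open>a w\<^sup>k\<close> with \<open>w\<^sup>n = 1\<close> and \<open>w\<^sup>2 \<noteq> 1\<close>, and so both their sum and
  the sum of their squares vanish. The sums of \<open>d\<^sub>i\<^sup>2\<close> and \<open>d\<^sub>i\<^sup>4\<close> involve only these two sums.
\<close>

text \<open>On the unit circle the distance to 1 determines the real part, and the real part
  determines the imaginary part up to sign.\<close>

lemma unit_complex_eq_or_cnj:
  fixes u v :: complex
  assumes "cmod u = 1" "cmod v = 1" "cmod (u - 1) = cmod (v - 1)"
  shows "u = v \<or> u = cnj v"
proof -
  have u: "(Re u)\<^sup>2 + (Im u)\<^sup>2 = 1" and v: "(Re v)\<^sup>2 + (Im v)\<^sup>2 = 1"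
    using assms(1,2) by (metis cmod_power2 one_power2)+
  have "(Re u - 1)\<^sup>2 + (Im u)\<^sup>2 = (Re v - 1)\<^sup>2 + (Im v)\<^sup>2"
    using arg_cong[OF assms(3), of "\<lambda>x. x\<^sup>2"] by (simp add: cmod_power2)
  with u v have re: "Re u = Re v"
    by (simp add: power2_eq_square algebra_simps)
  with u v have "(Im u)\<^sup>2 = (Im v)\<^sup>2" by simp
  with re show ?thesis
    by (auto simp: complex_eq_iff power2_eq_iff)
qed

text \<open>Indexing by all naturals lets a periodic extension of the vertices be used, so no
  wrap-around case arises. The bound \<open>w\<^sup>2 \<noteq> 1\<close> serves both geometric sums,
  with ratio \<open>w\<close> and with ratio \<open>w\<^sup>2\<close>.\<close>

lemma equal_chords_geometric:
  fixes z :: "nat \<Rightarrow> complex"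
  assumes "r > 0"
    and norm: "\<And>k. cmod (z k) = r"
    and side: "\<And>k. cmod (z (Suc k) - z k) = s"
    and ne: "\<And>k. z (Suc (Suc k)) \<noteq> z k"
  obtains w where "w\<^sup>2 \<noteq> 1" "\<And>k. z k = z 0 * w ^ k"
proof -
  have nz: "z k \<noteq> 0" for k
    using norm[of k] \<open>r > 0\<close> by auto
  define w where "w k = z (Suc k) / z k" for k
  have step: "z (Suc k) = z k * w k" for k
    using nz by (simp add: w_def)
  have unit: "cmod (w k) = 1" for k
    using norm \<open>r > 0\<close> by (simp add: w_def norm_divide)
  have dist1: "cmod (w k - 1) = s / r" for k
  proof -
    have "w k - 1 = (z (Suc k) - z k) / z k"
      using nz by (simp add: w_def diff_divide_distrib)
    then show ?thesis by (simp add: norm_divide norm side)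
  qed
  have prod_ne: "w k * w (Suc k) \<noteq> 1" for k
    using ne[of k] by (simp add: step mult.assoc)
  have "w (Suc k) = w k" for k
  proof -
    \<comment> \<open>For a unit number the conjugate is the inverse, so a conjugate successor would
      make the product 1.\<close>
    have "w k * cnj (w k) = 1"
      using unit[of k] by (simp add: complex_norm_square[symmetric])
    then have "w (Suc k) \<noteq> cnj (w k)"
      using prod_ne[of k] by auto
    then show ?thesis
      using unit_complex_eq_or_cnj[OF unit unit, of "Suc k" k] dist1 by simp
  qed
  then have w: "w k = w 0" for k
    by (induction k) auto
  have "z k = z 0 * w 0 ^ k" for k
  proof (induction k)
    case (Suc k)
    then show ?case using step[of k] w[of k] by simp
  qed simp
  moreover have "(w 0)\<^sup>2 \<noteq> 1"
    using prod_ne[of 0] w[of "Suc 0"] by (simp add: power2_eq_square)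
  ultimately show thesis using that by blast
qed

lemma sum_powers_root_of_unity:
  fixes w :: "'a::field"
  assumes "w ^ n = 1" "w \<noteq> 1"
  shows "(\<Sum>k<n. w ^ k) = 0"
  using assms by (simp add: geometric_sum)

text \<open>The squared distance is affine in \<open>p k\<close>, so its square is quadratic in
  \<open>p k\<close>. The linear terms cancel by \<open>sum1\<close>; the double-angle formula turns
  the quadratic ones into a constant plus terms that cancel by \<open>sum2\<close>.\<close>

lemma circle_distance_sums:
  fixes z :: "nat \<Rightarrow> complex"
  assumes m: "cmod m = r" and norm: "\<And>k. k < n \<Longrightarrow> cmod (z k) = r"
    and sum1: "(\<Sum>k<n. z k) = 0" and sum2: "(\<Sum>k<n. (z k)\<^sup>2) = 0"
  shows "(\<Sum>k<n. (cmod (m - z k))^2) = 2 * real n * r^2"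
    and "(\<Sum>k<n. (cmod (m - z k))^4) = 6 * real n * r^4"
proof -
  \<comment> \<open>The inner product of \<open>m\<close> and \<open>z k\<close> as plane
    vectors.\<close>
  define p where "p k = Re (m * cnj (z k))" for k
  have d: "(cmod (m - z k))\<^sup>2 = 2 * r\<^sup>2 - 2 * p k" if "k < n" for k
  proof -
    have "(cmod (m - z k))\<^sup>2 = (cmod m)\<^sup>2 + (cmod (z k))\<^sup>2 - 2 * p k"
      unfolding cmod_power2 by (simp add: p_def power2_eq_square algebra_simps)
    then show ?thesis using m norm[OF that] by simp
  qed
  have psq: "2 * (p k)\<^sup>2 = r^4 + Re (m\<^sup>2 * cnj ((z k)\<^sup>2))" if "k < n" for k
  proof -
    have "2 * (Re x)\<^sup>2 = (cmod x)\<^sup>2 + Re (x\<^sup>2)" for x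
      unfolding cmod_power2 by (simp add: power2_eq_square)
    from this[of "m * cnj (z k)"] show ?thesis
      using m norm[OF that]
      by (simp add: p_def norm_mult power_mult_distrib flip: power_add)
  qed
  have "(\<Sum>k<n. p k) = Re (m * cnj (\<Sum>k<n. z k))"
    by (simp only: p_def Re_sum cnj_sum sum_distrib_left)
  then have p0: "(\<Sum>k<n. p k) = 0" by (simp add: sum1)
  have "(\<Sum>k<n. Re (m\<^sup>2 * cnj ((z k)\<^sup>2))) = Re (m\<^sup>2 * cnj (\<Sum>k<n. (z k)\<^sup>2))"
    by (simp only: Re_sum cnj_sum sum_distrib_left)
  then have q0: "(\<Sum>k<n. Re (m\<^sup>2 * cnj ((z k)\<^sup>2))) = 0" by (simp add: sum2)
  have "(\<Sum>k<n. (cmod (m - z k))^2) = (\<Sum>k<n. 2 * r\<^sup>2 - 2 * p k)"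
    by (intro sum.cong) (auto simp: d)
  also have "\<dots> = 2 * real n * r\<^sup>2"
    by (simp add: sum_subtractf p0 flip: sum_distrib_left)
  finally show "(\<Sum>k<n. (cmod (m - z k))^2) = 2 * real n * r^2" .
  have "(cmod (m - z k))^4 = 6 * r^4 - 8 * r\<^sup>2 * p k + 2 * Re (m\<^sup>2 * cnj ((z k)\<^sup>2))"
    if "k < n" for k
  proof -
    have "(cmod (m - z k))^4 = ((cmod (m - z k))\<^sup>2)\<^sup>2"
      by (simp flip: power_mult)
    also have "\<dots> = 4 * r^4 - 8 * r\<^sup>2 * p k + 2 * (2 * (p k)\<^sup>2)"
      unfolding d[OF that] by (simp add: power2_eq_square power4_eq_xxxx algebra_simps)
    finally show ?thesis unfolding psq[OF that] by simp
  qed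
  then have "(\<Sum>k<n. (cmod (m - z k))^4)
      = (\<Sum>k<n. 6 * r^4 - 8 * r\<^sup>2 * p k + 2 * Re (m\<^sup>2 * cnj ((z k)\<^sup>2)))"
    by (intro sum.cong) auto
  also have "\<dots> = 6 * real n * r^4"
    unfolding sum.distrib sum_subtractf sum_distrib_left[symmetric] p0 q0 by simp
  finally show "(\<Sum>k<n. (cmod (m - z k))^4) = 6 * real n * r^4" .
qed

definition vec2_complex :: "real^2 \<Rightarrow> complex" where
  "vec2_complex x = Complex (x $ 1) (x $ 2)"

lemma cmod_vec2_complex_diff: "cmod (vec2_complex x - vec2_complex y) = dist x y"
  by (simp add: vec2_complex_def cmod_def dist_norm norm_vec_def L2_set_def UNIV_2)

lemma next_vertex_mod:
  assumes "n > 0"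
  shows "next_vertex n (Suc (k mod n)) = Suc (Suc k mod n)"
  using assms by (auto simp: next_vertex_def mod_Suc)

theorem theorem4p4:
  fixes n :: nat and A :: "nat \<Rightarrow> real^2" and C :: "(real^2) set" and M :: "real^2"
    and d :: "nat \<Rightarrow> real"
  assumes "n \<ge> 3"
    and "regular_polygon n A"
    and "circumscribed_circle n A C"
    and "M \<in> C"
    and "\<And>i. i \<in> {1..n} \<Longrightarrow> d i = dist M (A i)"
  shows "3 * (\<Sum>i=1..n. (d i)^2)^2 = 2 * real n * (\<Sum>i=1..n. (d i)^4)"
proof -
  obtain c r where "r > 0" and C: "C = sphere c r" and AC: "A ` {1..n} \<subseteq> C"
    using assms(3) by (auto simp: circumscribed_circle_def)
  obtain s where side: "\<And>i. i \<in> {1..n} \<Longrightarrow> dist (A i) (A (next_vertex n i)) = s"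
    and inj: "inj_on A {1..n}"
    using assms(2) by (auto simp: regular_polygon_def convex_polygon_def)
  define m where "m = vec2_complex M - vec2_complex c"
  \<comment> \<open>The centre is moved to the origin, and the vertices 1 to \<open>n\<close> become
    an \<open>n\<close>-periodic sequence starting at index 0.\<close>
  define z where "z k = vec2_complex (A (Suc (k mod n))) - vec2_complex c" for k
  have idx: "Suc (k mod n) \<in> {1..n}" for k
    using \<open>n \<ge> 3\<close> by (simp add: Suc_le_eq)
  have z_diff: "cmod (z j - z k) = dist (A (Suc (j mod n))) (A (Suc (k mod n)))" for j k
    by (simp add: z_def cmod_vec2_complex_diff)
  have norm_z: "cmod (z k) = r" for k
  proof -
    have "A (Suc (k mod n)) \<in> C" using AC idx[of k] by blast
    then show ?thesis by (simp add: z_def cmod_vec2_complex_diff C dist_commute)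
  qed
  have norm_m: "cmod m = r"
    using assms(4) by (simp add: m_def cmod_vec2_complex_diff C dist_commute)
  have side_z: "cmod (z (Suc k) - z k) = s" for k
    using side[OF idx[of k]] \<open>n \<ge> 3\<close> by (simp add: z_diff next_vertex_mod dist_commute)
  \<comment> \<open>Vertices are distinct, and \<open>n \<ge> 3\<close> keeps \<open>k\<close> and
    \<open>k + 2\<close> from being congruent modulo \<open>n\<close>.\<close>
  have ne: "z (Suc (Suc k)) \<noteq> z k" for k
  proof
    assume "z (Suc (Suc k)) = z k"
    then have "A (Suc (Suc (Suc k) mod n)) = A (Suc (k mod n))"
      using z_diff[of "Suc (Suc k)" k] by simp
    then have "Suc (Suc k) mod n = k mod n"
      using inj_onD[OF inj _ idx idx] by blast
    then show False
      using \<open>n \<ge> 3\<close> by (auto simp: mod_Suc split: if_splits)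
  qed
  obtain w where w2: "w\<^sup>2 \<noteq> 1" and zw: "\<And>k. z k = z 0 * w ^ k"
    using equal_chords_geometric[of r z, OF \<open>r > 0\<close> norm_z side_z ne] by blast
  have "z 0 \<noteq> 0" using norm_z[of 0] \<open>r > 0\<close> by auto
  \<comment> \<open>Periodicity closes the polygon and makes \<open>w\<close> an \<open>n\<close>-th
    root of unity.\<close>
  moreover have "z n = z 0" by (simp add: z_def)
  ultimately have wn: "w ^ n = 1" using zw[of n] by simp
  have "(\<Sum>k<n. z k) = z 0 * (\<Sum>k<n. w ^ k)"
    unfolding sum_distrib_left by (intro sum.cong refl zw)
  also have "(\<Sum>k<n. w ^ k) = 0"
    using wn w2 by (intro sum_powers_root_of_unity) auto
  finally have sum1: "(\<Sum>k<n. z k) = 0" by simp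
  have zw2: "(z k)\<^sup>2 = (z 0)\<^sup>2 * (w\<^sup>2) ^ k" for k
    unfolding zw[of k] power_mult_distrib by (simp only: power_mult[symmetric] mult.commute[of k])
  have "(w\<^sup>2) ^ n = (w ^ n)\<^sup>2"
    by (simp only: power_mult[symmetric] mult.commute[of n])
  then have "(w\<^sup>2) ^ n = 1" by (simp add: wn)
  then have w2n: "(\<Sum>k<n. (w\<^sup>2) ^ k) = 0"
    using w2 by (rule sum_powers_root_of_unity)
  have "(\<Sum>k<n. (z k)\<^sup>2) = (z 0)\<^sup>2 * (\<Sum>k<n. (w\<^sup>2) ^ k)"
    unfolding sum_distrib_left by (intro sum.cong refl zw2)
  with w2n have sum2: "(\<Sum>k<n. (z k)\<^sup>2) = 0" by simp
  have reindex: "(\<Sum>i=1..n. (d i) ^ e) = (\<Sum>k<n. (cmod (m - z k)) ^ e)" for e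
  proof -
    have "(\<Sum>i=1..n. (d i) ^ e) = (\<Sum>k<n. (d (Suc k)) ^ e)"
      by (simp add: sum.atLeast1_atMost_eq)
    also have "\<dots> = (\<Sum>k<n. (cmod (m - z k)) ^ e)"
      using assms(5) by (intro sum.cong) (auto simp: m_def z_def cmod_vec2_complex_diff)
    finally show ?thesis .
  qed
  show ?thesis
    \<comment> \<open>Both sides become \<open>12 * n\<^sup>2 * r^4\<close>.\<close>
    unfolding reindex circle_distance_sums[OF norm_m norm_z sum1 sum2]
    by (simp add: power2_eq_square power4_eq_xxxx)
qed

end
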